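(* Let $d\ge 1$, let $\lambda\in[-1,1/d)$, let $I\subset\mathbb{R}$ be an interval and let $\gamma:I\to\mathbb{R}^d$ be a continuous $\lambda$-curve. Then $\gamma$ is rectifiable. In particular, if moreover $\gamma(I)$ is bounded, then $\gamma$ has finite length.
   Context: $\mathbb{R}^d$ carries the Euclidean norm $\|\cdot\|$ and distance $d(x,y)=\|x-y\|$. For $\lambda\in[-1,1)$, a curve $\gamma:I\to\mathbb{R}^d$ ($I$ an interval) is a $\lambda$-curve if for all $t_1\le t_2\le t_3$ in $I$: $d(\gamma(t_1),\gamma(t_2))\le d(\gamma(t_1),\gamma(t_3))+\lambda\, d(\gamma(t_2),\gamma(t_3))$. The length of $\gamma$ is $\ell(\gamma)=\sup\sum_{i=0}^{m-1}\|\gamma(t_i)-\gamma(t_{i+1})\|$, the supremum over all finite increasing sequences $t_0<\dots<t_m$ in $I$; $\gamma$ is rectifiable if its length is locally finite (finite on every compact subinterval of $I$). *)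

theory Defs
  imports "HOL-Analysis.Analysis"
begin

definition lambda_curve :: "real \<Rightarrow> real set \<Rightarrow> (real \<Rightarrow> 'a::euclidean_space) \<Rightarrow> bool" where
  "lambda_curve lam I g \<longleftrightarrow>
     (\<forall>t1\<in>I. \<forall>t2\<in>I. \<forall>t3\<in>I. t1 \<le> t2 \<longrightarrow> t2 \<le> t3 \<longrightarrow>
        dist (g t1) (g t2) \<le> dist (g t1) (g t3) + lam * dist (g t2) (g t3))"

definition curve_length :: "(real \<Rightarrow> 'a::euclidean_space) \<Rightarrow> real set \<Rightarrow> ennreal" where
  "curve_length g I =
     (SUP p \<in> {(m, t). strict_mono_on {0..m} t \<and> (\<forall>i\<le>m. t i \<in> I)}.
        ennreal (\<Sum>i<fst p. norm (g (snd p i) - g (snd p (Suc i)))))"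

definition rectifiable_curve :: "(real \<Rightarrow> 'a::euclidean_space) \<Rightarrow> real set \<Rightarrow> bool" where
  "rectifiable_curve g I \<longleftrightarrow>
     (\<forall>a\<in>I. \<forall>b\<in>I. curve_length g {a..b} < \<infinity>)"

end

theory Submission
  imports Defs
begin

text \<open>
  Seen from a point of a \<open>\<lambda>\<close>-curve, the directions towards the past have pairwise inner products at
  least \<open>-\<lambda> > -1/d\<close>. By Caratheodory's theorem their convex hull stays at a distance \<open>\<delta> > 0\<close> from the
  origin, so some unit vector \<open>w\<close>, and by compactness of the sphere some member of a fixed finite
  set of unit vectors, makes an angle bounded away from \<open>\<pi>/2\<close> with all of them. Hence every step
  of an inscribed polygon lowers the running minimum of \<open>w \<bullet> \<gamma>\<close> by a fixed fraction of its distance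
  to the past, which is at least \<open>(1 - \<lambda>)/2\<close> times the length of the step. Summing the running
  minima over the finite set of directions bounds the length by a multiple of the diameter.
\<close>

text \<open>Expanding \<open>(norm z)\<^sup>2\<close> for a convex combination with weights
  \<open>u\<close>, the diagonal contributes the sum of the \<open>(u x)\<^sup>2\<close> and every
  other product is at least \<open>- lam\<close>. Caratheodory leaves at most
  \<open>DIM('a) + 1\<close> points, so the bound does not depend on the size of
  \<open>V\<close>.\<close>

lemma norm_convex_hull_ge:
  fixes V :: "'a::euclidean_space set" and lam :: real
  assumes lam: "-1 \<le> lam"
    and unit: "\<And>v. v \<in> V \<Longrightarrow> norm v = 1"
    and inner: "\<And>v w. v \<in> V \<Longrightarrow> w \<in> V \<Longrightarrow> - lam \<le> v \<bullet> w"
    and z: "z \<in> convex hull V"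
  shows "(1 - DIM('a) * lam) / (DIM('a) + 1) \<le> (norm z)\<^sup>2"
proof -
  obtain S where S: "finite S" "S \<subseteq> V" "card S \<le> DIM('a) + 1" "z \<in> convex hull S"
    using z unfolding caratheodory[of V] by auto
  obtain u where u: "\<And>x. x \<in> S \<Longrightarrow> 0 \<le> u x" "sum u S = 1" "(\<Sum>x\<in>S. u x *\<^sub>R x) = z"
    using S(4) unfolding convex_hull_finite[OF S(1)] by auto
  \<comment> \<open>Cauchy-Schwarz for weights of sum 1.\<close>
  have "1 \<le> (\<Sum>x\<in>S. (u x)\<^sup>2) * real (card S)"
    using sum_squared_le_sum_of_squares[of u S] u(2) by simp
  also have "\<dots> \<le> (\<Sum>x\<in>S. (u x)\<^sup>2) * (DIM('a) + 1)"
    using S(3) by (intro mult_left_mono sum_nonneg) (auto simp flip: of_nat_Suc)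
  finally have sq: "1 / (DIM('a) + 1) \<le> (\<Sum>x\<in>S. (u x)\<^sup>2)"
    by (simp add: field_simps)
  have "(1 - DIM('a) * lam) / (DIM('a) + 1) = (1 + lam) * (1 / (DIM('a) + 1)) - lam"
    by (simp add: field_simps)
  also have "\<dots> \<le> (1 + lam) * (\<Sum>x\<in>S. (u x)\<^sup>2) - lam * (sum u S * sum u S)"
    using mult_left_mono[OF sq, of "1 + lam"] lam u(2) by simp
  also have "\<dots> = (\<Sum>x\<in>S. \<Sum>y\<in>S. u x * u y * (if x = y then 1 else - lam))"
  proof -
    have "u x * u y * (if x = y then 1 else - lam)
        = (if x = y then (1 + lam) * (u x)\<^sup>2 else 0) - lam * (u x * u y)" for x y
      by (simp add: algebra_simps power2_eq_square)
    then show ?thesis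
      unfolding sum_product using S(1) by (simp add: sum_subtractf sum_distrib_left)
  qed
  also have "\<dots> \<le> (\<Sum>x\<in>S. \<Sum>y\<in>S. u x * u y * (x \<bullet> y))"
  proof (intro sum_mono mult_left_mono)
    fix x y assume "x \<in> S" "y \<in> S"
    then show "(if x = y then 1 else - lam) \<le> x \<bullet> y"
      using inner[of x y] unit[of x] S(2) by (auto simp: dot_square_norm)
    show "0 \<le> u x * u y"
      using u(1) \<open>x \<in> S\<close> \<open>y \<in> S\<close> by simp
  qed
  also have "\<dots> = (norm z)\<^sup>2"
    unfolding u(3)[symmetric] power2_norm_eq_inner
    by (simp add: inner_sum_left inner_sum_right sum_distrib_left mult_ac inner_commute)
  finally show ?thesis .
qed

text \<open>The direction \<open>w\<close> is the normalised point of the convex hull closest to the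
  origin; \<open>lam < 1 / DIM('a)\<close> keeps that point away from 0.\<close>

lemma unit_vector_inner_ge:
  fixes V :: "'a::euclidean_space set" and lam :: real
  assumes "finite V" and "-1 \<le> lam" and "lam < 1 / DIM('a)"
    and "\<And>v. v \<in> V \<Longrightarrow> norm v = 1"
    and "\<And>v w. v \<in> V \<Longrightarrow> w \<in> V \<Longrightarrow> - lam \<le> v \<bullet> w"
  obtains w where "norm w = 1"
    and "\<And>v. v \<in> V \<Longrightarrow> sqrt ((1 - DIM('a) * lam) / (DIM('a) + 1)) \<le> w \<bullet> v"
proof (cases "V = {}")
  case True
  then show ?thesis
    using that vector_choose_size[of 1] by (metis empty_iff zero_le_one)
next
  case False
  let ?K = "convex hull V"
  define z where "z = closest_point ?K 0"
  have K: "closed ?K" "convex ?K" "?K \<noteq> {}"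
    using assms(1) False by (auto simp: finite_imp_compact_convex_hull compact_imp_closed)
  have z: "z \<in> ?K"
    unfolding z_def using K by (simp add: closest_point_in_set)
  have "0 < (1 - DIM('a) * lam) / (DIM('a) + 1)"
    using assms(3) by (simp add: field_simps)
  moreover have le: "(1 - DIM('a) * lam) / (DIM('a) + 1) \<le> (norm z)\<^sup>2"
    using norm_convex_hull_ge assms z by blast
  ultimately have "z \<noteq> 0"
    by auto
  have "sqrt ((1 - DIM('a) * lam) / (DIM('a) + 1)) \<le> sgn z \<bullet> v" if "v \<in> V" for v
  proof -
    \<comment> \<open>Variational inequality for the projection of 0 onto the hull.\<close>
    have "(0 - z) \<bullet> (v - z) \<le> 0"
      unfolding z_def using K that
      by (intro closest_point_dot) (auto intro: hull_inc)
    then have "norm z * norm z \<le> z \<bullet> v"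
      by (simp add: inner_diff_right power2_norm_eq_inner flip: power2_eq_square)
    then have "norm z \<le> sgn z \<bullet> v"
      using \<open>z \<noteq> 0\<close> by (simp add: sgn_div_norm field_simps)
    moreover have "sqrt ((1 - DIM('a) * lam) / (DIM('a) + 1)) \<le> norm z"
      using le by (simp add: real_le_lsqrt)
    ultimately show ?thesis
      by linarith
  qed
  then show ?thesis
    using that[of "sgn z"] \<open>z \<noteq> 0\<close> by (simp add: norm_sgn)
qed

text \<open>Square the inequality and expand its left side by the law of cosines. What remains
  beyond the claim is \<open>b\<^sup>2 * (1 - lam\<^sup>2)\<close>, which is nonnegative.\<close>

lemma sgn_inner_sgn_ge:
  fixes p q x :: "'a::real_inner"
  assumes lam: "\<bar>lam\<bar> \<le> 1" and "p \<noteq> x" "q \<noteq> x"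
    and le: "dist p q \<le> dist p x + lam * dist q x"
  shows "- lam \<le> sgn (p - x) \<bullet> sgn (q - x)"
proof -
  define a b where "a = norm (p - x)" and "b = norm (q - x)"
  have pos: "0 < a" "0 < b"
    using assms(2,3) by (auto simp: a_def b_def)
  have "a\<^sup>2 + b\<^sup>2 - 2 * ((p - x) \<bullet> (q - x)) = (norm ((p - x) - (q - x)))\<^sup>2"
    unfolding a_def b_def
    unfolding power2_norm_eq_inner by (simp add: inner_diff_left inner_diff_right inner_commute)
  also have "\<dots> = (dist p q)\<^sup>2"
    by (simp add: dist_norm)
  also have "\<dots> \<le> (a + lam * b)\<^sup>2"
    using le by (intro power_mono) (auto simp: a_def b_def dist_norm)
  finally have "b\<^sup>2 * (1 - lam\<^sup>2) \<le> 2 * ((p - x) \<bullet> (q - x) + lam * (a * b))"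
    by (simp add: power2_eq_square algebra_simps)
  moreover have "lam\<^sup>2 \<le> 1"
    using lam by (simp add: abs_square_le_1)
  ultimately have "0 \<le> (p - x) \<bullet> (q - x) + lam * (a * b)"
    by (smt (verit) mult_nonneg_nonneg zero_le_power2)
  then have "- lam \<le> ((p - x) \<bullet> (q - x)) / (a * b)"
    using pos by (simp add: field_simps)
  then show ?thesis
    by (simp add: sgn_div_norm a_def b_def divide_inverse mult_ac)
qed

text \<open>Add the triangle inequality through \<open>p\<close>. In use, \<open>q\<close> is the
  last point before \<open>x\<close> and \<open>p\<close> any earlier one, so a step cannot be long
  while its end is close to the past.\<close>

lemma dist_past_ge:
  assumes "dist p q \<le> dist p x + lam * dist q x"
  shows "(1 - lam) / 2 * dist q x \<le> dist p x"
  using assms dist_triangle3[of q x p] by (simp add: field_simps)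

text \<open>The constant is chosen before the polygon, so the bound survives the supremum over all
  inscribed polygons.\<close>

lemma polygon_length_le:
  assumes "-1 \<le> lam" and "lam < 1 / DIM('a::euclidean_space)"
  obtains C where "\<And>(x :: nat \<Rightarrow> 'a) m D.
      (\<And>i j k. i \<le> j \<Longrightarrow> j \<le> k \<Longrightarrow> k \<le> m \<Longrightarrow>
        dist (x i) (x j) \<le> dist (x i) (x k) + lam * dist (x j) (x k)) \<Longrightarrow>
      (\<And>i. i \<le> m \<Longrightarrow> dist (x 0) (x i) \<le> D) \<Longrightarrow>
      (\<Sum>i<m. norm (x i - x (Suc i))) \<le> C * D"
proof -
  define \<delta> where "\<delta> = sqrt ((1 - DIM('a) * lam) / (DIM('a) + 1))"
  have "0 < \<delta>"
    using assms(2) by (simp add: \<delta>_def field_simps)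
  have "1 / real DIM('a) \<le> 1"
    by (simp add: Suc_le_eq)
  with assms have lam: "\<bar>lam\<bar> \<le> 1" "lam < 1"
    by linarith+
  \<comment> \<open>Moving a unit vector by less than \<open>\<delta>/2\<close> costs less than
    \<open>\<delta>/2\<close> in its inner product with any unit vector, so half of the margin
    \<open>\<delta>\<close> is left.\<close>
  obtain W where W: "finite W" "W \<subseteq> sphere (0::'a) 1" "sphere 0 1 \<subseteq> (\<Union>w\<in>W. ball w (\<delta>/2))"
    using compactE_image[OF compact_sphere, of "sphere (0::'a) 1" "\<lambda>w. ball w (\<delta>/2)" 0 1]
      \<open>0 < \<delta>\<close> by (metis UN_I centre_in_ball half_gt_zero open_ball subsetI)
  \<comment> \<open>The first factor is the remaining angular margin, the second comes from
    \<open>dist_past_ge\<close>.\<close>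
  define c where "c = \<delta> / 2 * ((1 - lam) / 2)"
  have "0 < c"
    using \<open>0 < \<delta>\<close> lam by (simp add: c_def)
  have bound: "(\<Sum>i<m. norm (x i - x (Suc i))) \<le> card W / c * D"
    if x: "\<And>i j k. i \<le> j \<Longrightarrow> j \<le> k \<Longrightarrow> k \<le> m \<Longrightarrow>
        dist (x i) (x j) \<le> dist (x i) (x k) + lam * dist (x j) (x k)"
      and D: "\<And>i. i \<le> m \<Longrightarrow> dist (x 0) (x i) \<le> D"
    for x :: "nat \<Rightarrow> 'a" and m D
  proof -
    define h where "h w i = Min ((\<lambda>j. w \<bullet> x j) ` {..i})" for w i
    have h_Suc: "h w (Suc i) = min (w \<bullet> x (Suc i)) (h w i)" for w i
      by (simp add: h_def atMost_Suc)
    have step: "c * norm (x i - x (Suc i)) \<le> (\<Sum>w\<in>W. h w i - h w (Suc i))" if "i < m" for i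
    proof -
      let ?q = "x (Suc i)"
      \<comment> \<open>Points equal to \<open>?q\<close> are left out because
        \<open>sgn 0 = 0\<close> is not a unit vector.\<close>
      define V where "V = (\<lambda>j. sgn (x j - ?q)) ` {j. j \<le> i \<and> x j \<noteq> ?q}"
      have "finite V"
        by (simp add: V_def)
      moreover have "norm v = 1" if "v \<in> V" for v
        using that by (auto simp: V_def norm_sgn)
      moreover have "- lam \<le> v \<bullet> w" if "v \<in> V" "w \<in> V" for v w
      proof -
        \<comment> \<open>The curve inequality needs \<open>j \<le> k\<close>; symmetry of the inner
          product then covers the other order.\<close>
        have le: "- lam \<le> sgn (x j - ?q) \<bullet> sgn (x k - ?q)"
          if "j \<le> k" "k \<le> i" "x j \<noteq> ?q" "x k \<noteq> ?q" for j k
          using that \<open>i < m\<close> lam by (intro sgn_inner_sgn_ge x) auto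
        have "- lam \<le> sgn (x j - ?q) \<bullet> sgn (x k - ?q)"
          if "j \<le> i" "k \<le> i" "x j \<noteq> ?q" "x k \<noteq> ?q" for j k
          using le[of j k] le[of k j] that by (metis inner_commute nle_le)
        with that show ?thesis
          by (auto simp: V_def)
      qed
      ultimately obtain w' where w': "norm w' = 1" "\<And>v. v \<in> V \<Longrightarrow> \<delta> \<le> w' \<bullet> v"
        using unit_vector_inner_ge[of V lam] assms unfolding \<delta>_def by metis
      obtain w where w: "w \<in> W" "dist w w' < \<delta> / 2"
        using W(3) w'(1) by force
      have past: "w \<bullet> ?q + c * norm (x i - ?q) \<le> w \<bullet> x j" if "j \<le> i" for j
      proof -
        have "\<delta> / 2 * norm (x j - ?q) \<le> w \<bullet> (x j - ?q)"
        proof (cases "x j = ?q")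
          case False
          let ?v = "sgn (x j - ?q)"
          have "\<delta> \<le> w' \<bullet> ?v"
            using that False by (intro w') (auto simp: V_def)
          moreover have "\<bar>(w - w') \<bullet> ?v\<bar> \<le> norm (w - w')"
            using Cauchy_Schwarz_ineq2[of "w - w'" ?v] False by (simp add: norm_sgn)
          ultimately have "\<delta> / 2 \<le> w \<bullet> ?v"
            using w(2) by (simp add: dist_norm inner_diff_left)
          then show ?thesis
            using False by (simp add: sgn_div_norm divide_simps mult_ac)
        qed simp
        moreover have "(1 - lam) / 2 * dist (x i) ?q \<le> dist (x j) ?q"
          using that \<open>i < m\<close> by (intro dist_past_ge x) auto
        then have "c * norm (x i - ?q) \<le> \<delta> / 2 * norm (x j - ?q)"
          using \<open>0 < \<delta>\<close> mult_left_mono[of "(1 - lam) / 2 * dist (x i) ?q" _ "\<delta> / 2"]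
          by (simp add: c_def dist_norm mult.assoc)
        ultimately show ?thesis
          by (simp add: inner_diff_right)
      qed
      have "w \<bullet> ?q + c * norm (x i - ?q) \<le> h w i"
        unfolding h_def using past by (intro Min.boundedI) auto
      then have "c * norm (x i - ?q) \<le> h w i - h w (Suc i)"
        by (simp add: h_Suc)
      \<comment> \<open>The good \<open>w\<close> varies with \<open>i\<close>. Summing over
        \<open>W\<close> removes this dependence, since running minima never increase and all
        summands are nonnegative.\<close>
      also have "\<dots> \<le> (\<Sum>w\<in>W. h w i - h w (Suc i))"
        using W(1) w(1) by (intro member_le_sum) (auto simp: h_Suc)
      finally show ?thesis .
    qed
    have "c * (\<Sum>i<m. norm (x i - x (Suc i))) \<le> (\<Sum>i<m. \<Sum>w\<in>W. h w i - h w (Suc i))"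
      unfolding sum_distrib_left using step by (intro sum_mono) auto
    also have "\<dots> = (\<Sum>w\<in>W. h w 0 - h w m)"
      by (subst sum.swap) (simp add: sum_lessThan_telescope')
    also have "\<dots> \<le> (\<Sum>w\<in>W. D)"
    proof (rule sum_mono)
      fix w assume "w \<in> W"
      \<comment> \<open>The total drop of \<open>h w\<close> is attained at a vertex, so it is at
        most the distance from \<open>x 0\<close> to that vertex.\<close>
      have "h w m \<in> (\<lambda>j. w \<bullet> x j) ` {..m}"
        unfolding h_def by (intro Min_in) auto
      then obtain j where j: "j \<le> m" "h w m = w \<bullet> x j"
        by auto
      then have "h w 0 - h w m = w \<bullet> (x 0 - x j)"
        by (simp add: h_def inner_diff_right)
      also have "\<dots> \<le> norm w * norm (x 0 - x j)"
        by (rule norm_cauchy_schwarz)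
      also have "\<dots> \<le> D"
        using D[OF j(1)] W(2) \<open>w \<in> W\<close> by (auto simp: dist_norm)
      finally show "h w 0 - h w m \<le> D" .
    qed
    finally show ?thesis
      using \<open>0 < c\<close> by (simp add: field_simps)
  qed
  then show ?thesis
    using that by blast
qed

text \<open>The diameter of the image serves as \<open>D\<close> for every inscribed polygon. This
  is applied to compact subintervals, where continuity gives boundedness, and to the whole of
  \<open>I\<close>.\<close>

lemma lambda_curve_length_finite:
  fixes g :: "real \<Rightarrow> 'a::euclidean_space"
  assumes "-1 \<le> lam" and "lam < 1 / DIM('a)"
    and "lambda_curve lam J g" and "bounded (g ` J)"
  shows "curve_length g J < \<infinity>"
proof -
  obtain C where C: "\<And>(x :: nat \<Rightarrow> 'a) m D.
      (\<And>i j k. i \<le> j \<Longrightarrow> j \<le> k \<Longrightarrow> k \<le> m \<Longrightarrow>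
        dist (x i) (x j) \<le> dist (x i) (x k) + lam * dist (x j) (x k)) \<Longrightarrow>
      (\<And>i. i \<le> m \<Longrightarrow> dist (x 0) (x i) \<le> D) \<Longrightarrow>
      (\<Sum>i<m. norm (x i - x (Suc i))) \<le> C * D"
    using polygon_length_le[OF assms(1,2)] by blast
  have "curve_length g J \<le> ennreal (C * diameter (g ` J))"
    unfolding curve_length_def
  proof (rule SUP_least, clarify)
    fix m :: nat and t :: "nat \<Rightarrow> real"
    assume t: "strict_mono_on {0..m} t" "\<forall>i\<le>m. t i \<in> J"
    have mono: "t i \<le> t j" if "i \<le> j" "j \<le> m" for i j
      using strict_mono_on_leD[OF t(1)] that by simp
    have "(\<Sum>i<m. norm (g (t i) - g (t (Suc i)))) \<le> C * diameter (g ` J)"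
    proof (rule C)
      fix i j k assume "i \<le> j" "j \<le> k" "k \<le> m"
      then show "dist (g (t i)) (g (t j)) \<le> dist (g (t i)) (g (t k)) + lam * dist (g (t j)) (g (t k))"
        using assms(3) t(2) mono unfolding lambda_curve_def by simp
    next
      fix i assume "i \<le> m"
      then show "dist (g (t 0)) (g (t i)) \<le> diameter (g ` J)"
        using t(2) by (intro diameter_bounded_bound assms(4)) auto
    qed
    then show "ennreal (\<Sum>i<fst (m, t). norm (g (snd (m, t) i) - g (snd (m, t) (Suc i))))
        \<le> ennreal (C * diameter (g ` J))"
      by (simp add: ennreal_leI)
  qed
  also have "\<dots> < \<infinity>"
    by simp
  finally show ?thesis .
qed

theorem theorem3p5:
  fixes \<gamma> :: "real \<Rightarrow> 'a::euclidean_space" and lam :: real and I :: "real set"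
  assumes "is_interval I"
    and "-1 \<le> lam" and "lam < 1 / real DIM('a)"
    and "continuous_on I \<gamma>"
    and "lambda_curve lam I \<gamma>"
  shows "rectifiable_curve \<gamma> I \<and> (bounded (\<gamma> ` I) \<longrightarrow> curve_length \<gamma> I < \<infinity>)"
proof
  show "rectifiable_curve \<gamma> I"
    unfolding rectifiable_curve_def
  proof (intro ballI)
    fix a b assume "a \<in> I" "b \<in> I"
    then have sub: "{a..b} \<subseteq> I"
      using assms(1) unfolding is_interval_1 by (meson atLeastAtMost_iff subsetI)
    then have "bounded (\<gamma> ` {a..b})"
      using assms(4) by (meson compact_Icc compact_continuous_image compact_imp_bounded
          continuous_on_subset)
    moreover have "lambda_curve lam {a..b} \<gamma>"
      using assms(5) sub unfolding lambda_curve_def by (meson subsetD)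
    ultimately show "curve_length \<gamma> {a..b} < \<infinity>"
      using assms(2,3) by (intro lambda_curve_length_finite)
  qed
  show "bounded (\<gamma> ` I) \<longrightarrow> curve_length \<gamma> I < \<infinity>"
    using assms(2,3,5) lambda_curve_length_finite by blast
qed

end
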